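(* Let the function $x\mapsto\psi_p(x)$ be lower semicontinuous at $\bar x$, and let $\bar r>0$ be such that $(t,u)\mapsto\psi_p^t(u)$ is upper semicontinuous at $(0,x)$ for any $x\in B(\bar x,\bar r)$. Furthermore, let $t_k\downarrow 0$, $r^k>0$, and let $(x^k)_k$ be a sequence of points of $X$ such that, for each $k$, $x^k$ is an optimal solution of the problem of minimizing $\psi_p^{t_k}$ over $X\cap B(x^k,r^k)$, i.e., $$\psi_p^{t_k}(x^k)\le\psi_p^{t_k}(x)\quad\text{for all } x\in X\cap B(x^k,r^k).$$ If, additionally, $\bar x$ is a cluster point of the sequence $(x^k)_k$ and $\liminf_{k\to\infty}r^k>0$, then $\bar x$ is a local optimal solution of the problem $\min_{x\in X}\psi_p(x)$.
   Context: Setting. $F,f:\mathbb{R}^n\times\mathbb{R}^m\to\mathbb{R}$, $G:\mathbb{R}^n\to\mathbb{R}^p$, $g:\mathbb{R}^n\times\mathbb{R}^m\to\mathbb{R}^q$ are twice continuously differentiable. Let $X=\{x\in\mathbb{R}^n: G(x)\le 0\}$ and $S(x)=\arg\min_y\{f(x,y): g(x,y)\le 0\}$. Standing assumptions: $S(x)\neq\varnothing$ if $x\in X$ and $S(x)=\varnothing$ otherwise; $f$ and $g_1,\dots,g_q$ are convex in $y$; Slater condition: for every $x\in X$ there is $y(x)\in\mathbb{R}^m$ with $g_i(x,y(x))<0$ for all $i$. Let $\mathcal{L}(x,y,u)=\nabla_y f(x,y)+\sum_{i=1}^q u_i\nabla_y g_i(x,y)$ and $\mathcal{D}(x)=\{(y,u)\in\mathbb{R}^{m+q}: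 \mathcal{L}(x,y,u)=0,\ u\ge 0,\ g(x,y)\le 0,\ u^\top g(x,y)=0\}$; for $t>0$, $\mathcal{D}^t(x)=\{(y,u)\in\mathbb{R}^{m+q}: \mathcal{L}(x,y,u)=0,\ u\ge 0,\ g(x,y)\le 0,\ -u_ig_i(x,y)\le t,\ i=1,\dots,q\}$, assumed nonempty throughout. Put $\psi_p(x)=\max_{(y,u)\in\mathcal{D}(x)}F(x,y)$ and $\psi_p^t(x)=\max_{(y,u)\in\mathcal{D}^t(x)}F(x,y)$ (optimal value functions; the value is understood as the supremum). By convention $\psi_p^0=\psi_p$, and $(t,u)\mapsto\psi_p^t(u)$ is considered on $[0,\infty)\times\mathbb{R}^n$. $t_k\downarrow 0$ means a sequence of positive numbers decreasing to $0$. $B(a,r)$ is the open ball with center $a$ and radius $r$. A point $\bar x\in X$ is a local optimal solution of $\min_{x\in X}\psi(x)$ if there is a neighborhood $U$ of $\bar x$ with $\psi(\bar x)\le\psi(x)$ for all $x\in X\cap U$. *)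

theory Defs
  imports "HOL-Analysis.Analysis"
begin

definition twice_continuously_differentiable ::
    "('a::real_normed_vector \<Rightarrow> 'b::real_normed_vector) \<Rightarrow> bool" where
  "twice_continuously_differentiable h \<longleftrightarrow>
     (\<exists>(h' :: 'a \<Rightarrow> 'a \<Rightarrow>\<^sub>L 'b) (h'' :: 'a \<Rightarrow> 'a \<Rightarrow>\<^sub>L ('a \<Rightarrow>\<^sub>L 'b)).
        (\<forall>z. (h has_derivative blinfun_apply (h' z)) (at z)) \<and>
        (\<forall>z. (h' has_derivative blinfun_apply (h'' z)) (at z)) \<and>
        continuous_on UNIV h'')"

definition gradient :: "('a::real_inner \<Rightarrow> real) \<Rightarrow> 'a \<Rightarrow> 'a" where
  "gradient h y = (THE D. GDERIV h y :> D)"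

(* The punctured filter "at z within S" suffices: including z itself in the lim inf or lim sup
   gives an equivalent condition. *)

definition lsc_within :: "('a::topological_space \<Rightarrow> ereal) \<Rightarrow> 'a \<Rightarrow> 'a set \<Rightarrow> bool" where
  "lsc_within h z S \<longleftrightarrow> h z \<le> Liminf (at z within S) h"

definition usc_within :: "('a::topological_space \<Rightarrow> ereal) \<Rightarrow> 'a \<Rightarrow> 'a set \<Rightarrow> bool" where
  "usc_within h z S \<longleftrightarrow> Limsup (at z within S) h \<le> h z"

definition local_optimal_solution ::
    "('a::topological_space \<Rightarrow> 'b::order) \<Rightarrow> 'a set \<Rightarrow> 'a \<Rightarrow> bool" where
  "local_optimal_solution \<psi> X z \<longleftrightarrow>
     z \<in> X \<and> (\<exists>U. open U \<and> z \<in> U \<and> (\<forall>x \<in> X \<inter> U. \<psi> z \<le> \<psi> x))"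

(* Inequalities between vectors are componentwise: this is the library order on real ^ 'k. *)

definition upper_feasible :: "(real ^ 'n \<Rightarrow> real ^ 'p) \<Rightarrow> (real ^ 'n) set" where
  "upper_feasible G = {x. G x \<le> 0}"

definition lower_solutions ::
    "((real ^ 'n) \<times> (real ^ 'm) \<Rightarrow> real) \<Rightarrow> ((real ^ 'n) \<times> (real ^ 'm) \<Rightarrow> real ^ 'q) \<Rightarrow>
     real ^ 'n \<Rightarrow> (real ^ 'm) set" where
  "lower_solutions f g x =
     {y. g (x, y) \<le> 0 \<and> (\<forall>z. g (x, z) \<le> 0 \<longrightarrow> f (x, y) \<le> f (x, z))}"

definition lagrange_gradient ::
    "((real ^ 'n) \<times> (real ^ 'm) \<Rightarrow> real) \<Rightarrow> ((real ^ 'n) \<times> (real ^ 'm) \<Rightarrow> real ^ 'q) \<Rightarrow>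
     real ^ 'n \<Rightarrow> real ^ 'm \<Rightarrow> real ^ 'q \<Rightarrow> real ^ 'm" where
  "lagrange_gradient f g x y u =
     gradient (\<lambda>z. f (x, z)) y + (\<Sum>i\<in>UNIV. (u $ i) *\<^sub>R gradient (\<lambda>z. g (x, z) $ i) y)"

definition KKT_set ::
    "((real ^ 'n) \<times> (real ^ 'm) \<Rightarrow> real) \<Rightarrow> ((real ^ 'n) \<times> (real ^ 'm) \<Rightarrow> real ^ 'q) \<Rightarrow>
     real ^ 'n \<Rightarrow> ((real ^ 'm) \<times> (real ^ 'q)) set" where
  "KKT_set f g x =
     {(y, u). lagrange_gradient f g x y u = 0 \<and> 0 \<le> u \<and> g (x, y) \<le> 0 \<and> u \<bullet> g (x, y) = 0}"

definition relaxed_KKT_set ::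
    "((real ^ 'n) \<times> (real ^ 'm) \<Rightarrow> real) \<Rightarrow> ((real ^ 'n) \<times> (real ^ 'm) \<Rightarrow> real ^ 'q) \<Rightarrow>
     real \<Rightarrow> real ^ 'n \<Rightarrow> ((real ^ 'm) \<times> (real ^ 'q)) set" where
  "relaxed_KKT_set f g t x =
     {(y, u). lagrange_gradient f g x y u = 0 \<and> 0 \<le> u \<and> g (x, y) \<le> 0 \<and>
              (\<forall>i. - (u $ i) * (g (x, y) $ i) \<le> t)}"

(* The value functions are extended-real suprema: \<infinity> if F is unbounded above on the
   constraint set, -\<infinity> if that set is empty. *)

definition psi_p ::
    "((real ^ 'n) \<times> (real ^ 'm) \<Rightarrow> real) \<Rightarrow> ((real ^ 'n) \<times> (real ^ 'm) \<Rightarrow> real) \<Rightarrow>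
     ((real ^ 'n) \<times> (real ^ 'm) \<Rightarrow> real ^ 'q) \<Rightarrow> real ^ 'n \<Rightarrow> ereal" where
  "psi_p F f g x = (SUP (y, u) \<in> KKT_set f g x. ereal (F (x, y)))"

definition psi_p_relaxed ::
    "((real ^ 'n) \<times> (real ^ 'm) \<Rightarrow> real) \<Rightarrow> ((real ^ 'n) \<times> (real ^ 'm) \<Rightarrow> real) \<Rightarrow>
     ((real ^ 'n) \<times> (real ^ 'm) \<Rightarrow> real ^ 'q) \<Rightarrow> real \<Rightarrow> real ^ 'n \<Rightarrow> ereal" where
  "psi_p_relaxed F f g t x =
     (if t = 0 then psi_p F f g x
      else (SUP (y, u) \<in> relaxed_KKT_set f g t x. ereal (F (x, y))))"

end

theory Submission
  imports Defs
begin

text \<open>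
  The relaxed value functions dominate \<open>psi_p\<close>. If some \<open>z \<in> X\<close> close to \<open>xbar\<close> had a smaller value
  than \<open>xbar\<close>, choose \<open>c\<close> strictly between the two values. For late indices \<open>k\<close> of the subsequence
  the radii are bounded below, so \<open>z\<close> lies in the ball around \<open>x k\<close>, and
  \<open>c < psi_p (x k) \<le> psi_p_relaxed (t k) (x k) \<le> psi_p_relaxed (t k) z < c\<close>, where the outer
  inequalities come from lower semicontinuity at \<open>xbar\<close> and upper semicontinuity at \<open>(0, z)\<close>.
\<close>

text \<open>By the sign conditions every product \<open>u $ i * g (x, y) $ i\<close> is nonpositive,
  and complementarity makes these products sum to zero, so each one vanishes.\<close>

lemma KKT_set_subset_relaxed:
  assumes "0 \<le> t"
  shows "KKT_set f g x \<subseteq> relaxed_KKT_set f g t x"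
proof (clarsimp simp: KKT_set_def relaxed_KKT_set_def)
  fix y u i
  assume "0 \<le> u" and "g (x, y) \<le> 0" and compl: "u \<bullet> g (x, y) = 0"
  then have nonneg: "0 \<le> - (u $ j * g (x, y) $ j)" for j
    by (simp add: less_eq_vec_def mult_nonneg_nonpos)
  have "(\<Sum>j\<in>UNIV. - (u $ j * g (x, y) $ j)) = 0"
    using compl by (simp add: inner_vec_def sum_negf)
  then have "u $ i * g (x, y) $ i = 0"
    using nonneg by (subst (asm) sum_nonneg_eq_0_iff) auto
  then show "- (u $ i * g (x, y) $ i) \<le> t"
    using assms by linarith
qed

lemma psi_p_le_relaxed:
  assumes "0 \<le> t"
  shows "psi_p F f g x \<le> psi_p_relaxed F f g t x"
  by (simp add: psi_p_def psi_p_relaxed_def SUP_subset_mono[OF KKT_set_subset_relaxed[OF assms]])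

lemma closed_upper_feasible:
  assumes "continuous_on UNIV G"
  shows "closed (upper_feasible G)"
proof -
  have "upper_feasible G = (\<Inter>i. {x. G x $ i \<le> 0})"
    by (auto simp: upper_feasible_def less_eq_vec_def)
  also have "closed \<dots>"
    by (intro closed_INT ballI closed_Collect_le continuous_on_component assms continuous_on_const)
  finally show ?thesis .
qed

lemma twice_continuously_differentiable_imp_continuous_on:
  assumes "twice_continuously_differentiable h"
  shows "continuous_on S h"
  using assms unfolding twice_continuously_differentiable_def
  by (meson has_derivative_continuous continuous_at_imp_continuous_on)

text \<open>\<open>Liminf\<close> over the punctured filter controls only points other than
  \<open>z\<close>; the strict bound at \<open>z\<close> itself extends this to a full
  neighbourhood. This matters because iterates may coincide with the limit point.\<close>

lemma lsc_within_eventually_nhds: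
  assumes "lsc_within h z UNIV" "c < h z"
  shows "\<forall>\<^sub>F w in nhds z. c < h w"
  using assms by (auto simp: lsc_within_def le_Liminf_iff eventually_nhds_conv_at)

lemma usc_within_eventually_seq:
  assumes "usc_within h z S" "h z < c"
    and "X \<longlonglongrightarrow> z" "\<And>k. X k \<in> S" "\<And>k. X k \<noteq> z"
  shows "\<forall>\<^sub>F k in sequentially. h (X k) < c"
proof -
  have "filterlim X (at z within S) sequentially"
    using assms by (simp add: filterlim_at)
  moreover have "\<forall>\<^sub>F w in at z within S. h w < c"
    using assms(1,2) by (simp add: usc_within_def Limsup_le_iff)
  ultimately show ?thesis
    by (rule eventually_compose_filterlim[rotated])
qed

theorem theorem3p2:
  fixes F f :: "(real ^ 'n) \<times> (real ^ 'm) \<Rightarrow> real"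
    and G :: "real ^ 'n \<Rightarrow> real ^ 'p"
    and g :: "(real ^ 'n) \<times> (real ^ 'm) \<Rightarrow> real ^ 'q"
    and X :: "(real ^ 'n) set"
    and xbar :: "real ^ 'n" and rbar :: real
    and t r :: "nat \<Rightarrow> real" and x :: "nat \<Rightarrow> real ^ 'n"
  assumes X_eq: "X = upper_feasible G"
    and C2: "twice_continuously_differentiable F" "twice_continuously_differentiable f"
            "twice_continuously_differentiable G" "twice_continuously_differentiable g"
    and solvable_iff: "\<And>z. lower_solutions f g z \<noteq> {} \<longleftrightarrow> z \<in> X"
    and convex_f: "\<And>z. convex_on UNIV (\<lambda>y. f (z, y))"
    and convex_g: "\<And>z i. convex_on UNIV (\<lambda>y. g (z, y) $ i)"
    and slater: "\<And>z. z \<in> X \<Longrightarrow> \<exists>y. \<forall>i. g (z, y) $ i < 0"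
    and relaxed_nonempty: "\<And>s z. s > 0 \<Longrightarrow> z \<in> X \<Longrightarrow> relaxed_KKT_set f g s z \<noteq> {}"
    and lsc: "lsc_within (psi_p F f g) xbar UNIV"
    and rbar_pos: "rbar > 0"
    and usc: "\<And>z. z \<in> ball xbar rbar \<Longrightarrow>
                usc_within (\<lambda>(s, v). psi_p_relaxed F f g s v) (0, z) ({0..} \<times> UNIV)"
    and t_pos: "\<And>k. t k > 0" and t_decreasing: "decseq t" and t_lim: "t \<longlonglongrightarrow> 0"
    and r_pos: "\<And>k. r k > 0"
    and x_in: "\<And>k. x k \<in> X"
    and x_opt: "\<And>k z. z \<in> X \<inter> ball (x k) (r k) \<Longrightarrow>
                  psi_p_relaxed F f g (t k) (x k) \<le> psi_p_relaxed F f g (t k) z"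
    and cluster: "\<exists>\<sigma>. strict_mono \<sigma> \<and> (x \<circ> \<sigma>) \<longlonglongrightarrow> xbar"
    and r_liminf: "liminf (\<lambda>k. ereal (r k)) > 0"
  shows "local_optimal_solution (psi_p F f g) X xbar"
proof -
  from cluster obtain \<sigma> where \<sigma>: "strict_mono \<sigma>" and x\<sigma>: "(\<lambda>k. x (\<sigma> k)) \<longlonglongrightarrow> xbar"
    by (auto simp: o_def)
  have t\<sigma>: "(\<lambda>k. t (\<sigma> k)) \<longlonglongrightarrow> 0"
    using LIMSEQ_subseq_LIMSEQ[OF t_lim \<sigma>] by (simp add: o_def)
  \<comment> \<open>Feasibility of \<open>xbar\<close> is part of local optimality; it is inherited
    from the iterates because \<open>X\<close> is closed.\<close>
  have "closed X"
    unfolding X_eq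
    by (intro closed_upper_feasible twice_continuously_differentiable_imp_continuous_on C2)
  then have xbar_in: "xbar \<in> X"
    by (rule closed_sequentially[OF _ _ x\<sigma>]) (rule x_in)
  \<comment> \<open>The liminf may be infinite, so a real \<open>\<rho>\<close> strictly below it
    serves as the eventual lower bound for the radii.\<close>
  from r_liminf obtain \<rho> where "0 < ereal \<rho>" and "ereal \<rho> < liminf (\<lambda>k. ereal (r k))"
    using ereal_dense2 by blast
  then have \<rho>: "0 < \<rho>" and "\<forall>\<^sub>F k in sequentially. \<rho> < r k"
    using less_LiminfD by fastforce+
  then have r\<sigma>: "\<forall>\<^sub>F k in sequentially. \<rho> < r (\<sigma> k)"
    using eventually_subseq[OF \<sigma>] by blast
  \<comment> \<open>The bound \<open>rbar\<close> gives upper semicontinuity at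
    \<open>(0, z)\<close>. The bound \<open>\<rho> / 2\<close> leaves the other half of
    \<open>\<rho>\<close> for the distance from \<open>x (\<sigma> k)\<close> to
    \<open>xbar\<close>.\<close>
  have "psi_p F f g xbar \<le> psi_p F f g z"
    if "z \<in> X" and z: "dist xbar z < min rbar (\<rho> / 2)" for z
  proof (rule ccontr)
    assume "\<not> ?thesis"
    then obtain c where c: "psi_p F f g z < c" "c < psi_p F f g xbar"
      using dense not_le by metis
    have "\<forall>\<^sub>F k in sequentially. c < psi_p F f g (x (\<sigma> k))"
      by (rule eventually_compose_filterlim[OF lsc_within_eventually_nhds[OF lsc c(2)] x\<sigma>])
    moreover have "\<forall>\<^sub>F k in sequentially.
        (\<lambda>(s, v). psi_p_relaxed F f g s v) (t (\<sigma> k), z) < c"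
    proof (rule usc_within_eventually_seq[OF usc])
      show "z \<in> ball xbar rbar"
        using z by simp
      \<comment> \<open>At parameter 0 the relaxed value is \<open>psi_p\<close> by convention, so
        this is the choice of \<open>c\<close>.\<close>
      show "(\<lambda>(s, v). psi_p_relaxed F f g s v) (0, z) < c"
        using c by (simp add: psi_p_relaxed_def)
      show "(\<lambda>k. (t (\<sigma> k), z)) \<longlonglongrightarrow> (0, z)"
        by (intro tendsto_Pair t\<sigma> tendsto_const)
    \<comment> \<open>Positivity of \<open>t\<close> keeps the pairs in the domain and away from
      \<open>(0, z)\<close>, as the punctured filter requires, although the second component stays
      equal to \<open>z\<close>.\<close>
    qed (use t_pos in \<open>auto simp: less_imp_le less_imp_neq[symmetric]\<close>)
    moreover have "\<forall>\<^sub>F k in sequentially. dist (x (\<sigma> k)) xbar < \<rho> / 2"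
      using tendstoD[OF x\<sigma> half_gt_zero[OF \<rho>]] .
    ultimately have "\<forall>\<^sub>F k in sequentially. False"
      using r\<sigma>
    proof eventually_elim
      case (elim k)
      have "dist (x (\<sigma> k)) z < r (\<sigma> k)"
        using elim(3,4) z dist_triangle[of "x (\<sigma> k)" z xbar] by simp
      then have "psi_p_relaxed F f g (t (\<sigma> k)) (x (\<sigma> k)) \<le> psi_p_relaxed F f g (t (\<sigma> k)) z"
        using x_opt \<open>z \<in> X\<close> by simp
      moreover have "psi_p F f g (x (\<sigma> k)) \<le> psi_p_relaxed F f g (t (\<sigma> k)) (x (\<sigma> k))"
        by (simp add: psi_p_le_relaxed t_pos less_imp_le)
      ultimately show ?case
        using elim(1,2) by simp
    qed
    then show False
      by simp
  qed
  then show ?thesis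
    unfolding local_optimal_solution_def using xbar_in rbar_pos \<rho>
    by (intro conjI exI[of _ "ball xbar (min rbar (\<rho> / 2))"]) auto
qed

end
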